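(* Let $n\ge 1$ and let $\Bbbk$ be a field. If $n\equiv 3\bmod 4$ (or $n\equiv 1\bmod 4$ and $\operatorname{char}(\Bbbk)=2$), then the cluster variety $V(\mathcal{A}(A_n),\Bbbk)$ has a unique deep point, whose values on the diagonals $x_{i,j}$ ($i<j$) in $\Delta_{n+3}$ are given by $$p(x_{i,j})=\begin{cases}(-1)^{\frac{j-i-1}{2}} & \text{if } i\not\equiv j\bmod 2,\\ 0 & \text{if } i\equiv j\bmod 2.\end{cases}$$ For all other choices of $n$ and $\Bbbk$, the cluster variety $V(\mathcal{A}(A_n),\Bbbk)$ has no deep points.
   Context: For $N\ge3$, $\Delta_N$ is a convex $N$-gon with vertices indexed clockwise $1,\dots,N$, and $$P_{2,N}=\mathbb{Z}[x_{i,j}:1\le i<j\le N]\big/\big\langle x_{i,k}x_{j,l}-(x_{i,j}x_{k,l}+x_{i,l}x_{j,k}):1\le i<j<k<l\le N\big\rangle .$$ The generator $x_{i,j}$ is identified with the segment joining vertices $i$ and $j$; it is an edge if $j=i+1$ or $(i,j)=(1,N)$, and a diagonal otherwise. The cluster algebra of type $A_n$ with no frozen variables is $\mathcal{A}(A_n)=P_{2,n+3}/\langle x_{i,j}-1:x_{i,j}\text{ an edge of }\Delta_{n+3}\rangle$; its cluster variables are the diagonals of $\Delta_{n+3}$ and its clusters are the triangulations of $\Delta_{n+3}$ (sets of diagonals). $V(\mathcal{A}(A_n),\Bbbk)=\mathrm{Hom}_{\mathrm{Ring}}(\mathcal{A}(A_n),\Bbbk)$. A point $p$ is deep if every triangulation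 of $\Delta_{n+3}$ contains a diagonal $x_{i,j}$ with $p(x_{i,j})=0$. *)

theory Defs
  imports
    "HOL-Library.Poly_Mapping"
    "HOL-Algebra.QuotRing"
    "HOL-Algebra.Algebraic_Closure_Type"
begin

section \<open>Combinatorics of the convex polygon\<close>

text \<open>The segment joining vertices i and j is encoded as the pair (i, j) with i < j.\<close>

definition segments :: "nat \<Rightarrow> (nat \<times> nat) set" where
  "segments N = {(i, j). 1 \<le> i \<and> i < j \<and> j \<le> N}"

definition edges :: "nat \<Rightarrow> (nat \<times> nat) set" where
  "edges N = {(i, j) \<in> segments N. j = i + 1 \<or> (i = 1 \<and> j = N)}"

definition diagonals :: "nat \<Rightarrow> (nat \<times> nat) set" where
  "diagonals N = segments N - edges N"

text \<open>Two segments cross if they meet in a point interior to both.\<close>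

fun crosses :: "nat \<times> nat \<Rightarrow> nat \<times> nat \<Rightarrow> bool" where
  "crosses (i, j) (k, l) \<longleftrightarrow> (i < k \<and> k < j \<and> j < l) \<or> (k < i \<and> i < l \<and> l < j)"

definition noncrossing :: "(nat \<times> nat) set \<Rightarrow> bool" where
  "noncrossing T \<longleftrightarrow> (\<forall>d\<in>T. \<forall>e\<in>T. \<not> crosses d e)"

text \<open>A triangulation is a maximal set of pairwise non-crossing diagonals.\<close>

definition triangulations :: "nat \<Rightarrow> (nat \<times> nat) set set" where
  "triangulations N =
     {T. T \<subseteq> diagonals N \<and> noncrossing T \<and>
         (\<forall>d \<in> diagonals N - T. \<not> noncrossing (insert d T))}"


section \<open>The ring of the polygon and its quotient by the edges\<close>

text \<open>Integer polynomials in variables indexed by pairs: finitely supported maps from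
  monomials (finitely supported exponent functions) to coefficients, with the convolution
  product of \<^theory>\<open>HOL-Library.Poly_Mapping\<close>.\<close>

type_synonym zpoly = "((nat \<times> nat) \<Rightarrow>\<^sub>0 nat) \<Rightarrow>\<^sub>0 int"

definition var :: "nat \<times> nat \<Rightarrow> zpoly" where
  "var e = Poly_Mapping.single (Poly_Mapping.single e 1) 1"

text \<open>Only the variables indexed by segments of the N-gon may occur, so this is
  the polynomial ring over the integers in exactly these variables.\<close>

definition segment_poly_ring :: "nat \<Rightarrow> zpoly ring" where
  "segment_poly_ring N =
     ring_of_type_algebra
       \<lparr>carrier := {f. \<forall>m \<in> Poly_Mapping.keys f. Poly_Mapping.keys m \<subseteq> segments N}\<rparr>"

definition pluecker_relations :: "nat \<Rightarrow> zpoly set" where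
  "pluecker_relations N =
     {var (i, k) * var (j, l) - (var (i, j) * var (k, l) + var (i, l) * var (j, k)) | i j k l.
        1 \<le> i \<and> i < j \<and> j < k \<and> k < l \<and> l \<le> N}"

definition pluecker_ideal :: "nat \<Rightarrow> zpoly set" where
  "pluecker_ideal N = Idl\<^bsub>segment_poly_ring N\<^esub> (pluecker_relations N)"

definition pluecker_ring :: "nat \<Rightarrow> zpoly set ring" where
  "pluecker_ring N = segment_poly_ring N Quot pluecker_ideal N"

definition pluecker_gen :: "nat \<Rightarrow> nat \<times> nat \<Rightarrow> zpoly set" where
  "pluecker_gen N e = pluecker_ideal N +>\<^bsub>segment_poly_ring N\<^esub> var e"

definition edge_ideal :: "nat \<Rightarrow> zpoly set set" where
  "edge_ideal N =
     Idl\<^bsub>pluecker_ring N\<^esub>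
       ((\<lambda>e. pluecker_gen N e \<ominus>\<^bsub>pluecker_ring N\<^esub> \<one>\<^bsub>pluecker_ring N\<^esub>) ` edges N)"

definition cluster_algebra_A :: "nat \<Rightarrow> zpoly set set ring" where
  "cluster_algebra_A n = pluecker_ring (n + 3) Quot edge_ideal (n + 3)"

text \<open>The image in the cluster algebra of the generator indexed by a segment.\<close>

definition cluster_gen :: "nat \<Rightarrow> nat \<times> nat \<Rightarrow> zpoly set set" where
  "cluster_gen n e = edge_ideal (n + 3) +>\<^bsub>pluecker_ring (n + 3)\<^esub> pluecker_gen (n + 3) e"


section \<open>The cluster variety and its deep points\<close>

text \<open>\<^const>\<open>ring_hom\<close> (which requires 1 to be sent to 1) constrains functions on the carrier
  only. Restricting to functions that are \<^const>\<open>undefined\<close> outside the carrier makes equality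
  of points coincide with equality of homomorphisms.\<close>

definition cluster_variety :: "nat \<Rightarrow> (zpoly set set \<Rightarrow> 'k::field) set" where
  "cluster_variety n =
     ring_hom (cluster_algebra_A n) ring_of_type_algebra
       \<inter> extensional (carrier (cluster_algebra_A n))"

definition deep_points :: "nat \<Rightarrow> (zpoly set set \<Rightarrow> 'k::field) set" where
  "deep_points n =
     {p \<in> cluster_variety n.
        \<forall>T \<in> triangulations (n + 3). \<exists>d\<in>T. p (cluster_gen n d) = 0}"


section \<open>The quotients are taken in commutative rings\<close>

lemma cring_segment_poly_ring: "cring (segment_poly_ring N)"
proof -
  let ?C = "{f :: zpoly. \<forall>m \<in> Poly_Mapping.keys f. Poly_Mapping.keys m \<subseteq> segments N}"
  have add: "f + g \<in> ?C" if "f \<in> ?C" "g \<in> ?C" for f g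
    using that Poly_Mapping.keys_add[of f g] by blast
  have mult: "f * g \<in> ?C" if fg: "f \<in> ?C" "g \<in> ?C" for f g
  proof (clarify)
    fix m a b assume "m \<in> Poly_Mapping.keys (f * g)" and ab: "(a, b) \<in> Poly_Mapping.keys m"
    then obtain u v where "m = u + v" "u \<in> Poly_Mapping.keys f" "v \<in> Poly_Mapping.keys g"
      using Poly_Mapping.keys_mult[of f g] by blast
    then show "(a, b) \<in> segments N"
      using fg ab Poly_Mapping.keys_add[of u v] by blast
  qed
  have uminus: "- f \<in> ?C" if "f \<in> ?C" for f
    using that by (auto simp: in_keys_iff)
  have carrier: "carrier (segment_poly_ring N) = ?C"
    and ops: "f \<oplus>\<^bsub>segment_poly_ring N\<^esub> g = f + g" "f \<otimes>\<^bsub>segment_poly_ring N\<^esub> g = f * g"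
      "\<zero>\<^bsub>segment_poly_ring N\<^esub> = 0" "\<one>\<^bsub>segment_poly_ring N\<^esub> = 1" for f g
    by (simp_all add: segment_poly_ring_def ring_of_type_algebra_def)
  have zero: "0 \<in> ?C" and one: "1 \<in> ?C"
    by simp_all
  show ?thesis
  proof (intro cringI abelian_groupI comm_monoidI, unfold carrier ops)
    fix f assume "f \<in> ?C"
    then show "\<exists>g \<in> ?C. g + f = 0"
      using uminus by (intro bexI[of _ "- f"]) simp_all
  qed (fact add mult zero one | rule distrib_right | simp only: ac_simps add_0_left add_0_right mult_1_left mult_1_right)+
qed

lemma var_closed: "e \<in> segments N \<Longrightarrow> var e \<in> carrier (segment_poly_ring N)"
  by (simp add: segment_poly_ring_def var_def)

lemma pluecker_relations_closed: "pluecker_relations N \<subseteq> carrier (segment_poly_ring N)"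
proof
  interpret R: cring "segment_poly_ring N" by (rule cring_segment_poly_ring)
  have add: "f + g \<in> carrier (segment_poly_ring N)" and mult: "f * g \<in> carrier (segment_poly_ring N)"
    if "f \<in> carrier (segment_poly_ring N)" "g \<in> carrier (segment_poly_ring N)" for f g
    using R.a_closed[OF that] R.m_closed[OF that]
    by (simp_all add: segment_poly_ring_def ring_of_type_algebra_def)
  have diff: "f - g \<in> carrier (segment_poly_ring N)"
    if "f \<in> carrier (segment_poly_ring N)" "g \<in> carrier (segment_poly_ring N)" for f g
  proof -
    have "- g \<in> carrier (segment_poly_ring N)"
      using that(2) by (auto simp: segment_poly_ring_def in_keys_iff)
    from add[OF that(1) this] show ?thesis by simp
  qed
  fix f assume "f \<in> pluecker_relations N"
  then obtain i j k l where f: "f = var (i, k) * var (j, l)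
      - (var (i, j) * var (k, l) + var (i, l) * var (j, k))"
    and ord: "1 \<le> i" "i < j" "j < k" "k < l" "l \<le> N"
    unfolding pluecker_relations_def by blast
  have "var (a, b) \<in> carrier (segment_poly_ring N)"
    if "(a, b) \<in> {(i, k), (j, l), (i, j), (k, l), (i, l), (j, k)}" for a b
    using that ord by (intro var_closed) (auto simp: segments_def)
  then show "f \<in> carrier (segment_poly_ring N)"
    unfolding f by (intro diff add mult) auto
qed

lemma ideal_pluecker_ideal: "ideal (pluecker_ideal N) (segment_poly_ring N)"
  unfolding pluecker_ideal_def
  by (intro ring.genideal_ideal pluecker_relations_closed cring.axioms(1) cring_segment_poly_ring)

lemma cring_pluecker_ring: "cring (pluecker_ring N)"
  unfolding pluecker_ring_def
  by (intro ideal.quotient_is_cring ideal_pluecker_ideal cring_segment_poly_ring)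

lemma pluecker_gen_closed: "e \<in> segments N \<Longrightarrow> pluecker_gen N e \<in> carrier (pluecker_ring N)"
  unfolding pluecker_gen_def pluecker_ring_def FactRing_def A_RCOSETS_def'
  using var_closed[of e N] by auto

lemma ideal_edge_ideal: "ideal (edge_ideal N) (pluecker_ring N)"
proof -
  interpret P: cring "pluecker_ring N" by (rule cring_pluecker_ring)
  show ?thesis
    unfolding edge_ideal_def
    by (intro P.genideal_ideal) (auto simp: edges_def intro!: P.minus_closed pluecker_gen_closed)
qed

lemma cring_cluster_algebra_A: "cring (cluster_algebra_A n)"
  unfolding cluster_algebra_A_def
  by (intro ideal.quotient_is_cring ideal_edge_ideal cring_pluecker_ring)

lemma cluster_gen_closed:
  "e \<in> segments (n + 3) \<Longrightarrow> cluster_gen n e \<in> carrier (cluster_algebra_A n)"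
  unfolding cluster_gen_def cluster_algebra_A_def FactRing_def A_RCOSETS_def'
  using pluecker_gen_closed[of e "n + 3"] by auto

end

theory Submission
  imports Defs
begin

text \<open>
  By the universal properties of polynomial rings and quotients, a point of the cluster variety is
  the same as a frieze: a table of field elements \<open>a (i, j)\<close>, one for each segment of the
  \<open>N\<close>-gon with \<open>N = n + 3\<close>, that satisfies the Pluecker relations and equals 1 on the edges
  (\<open>point_frieze\<close>, \<open>frieze_point\<close>, \<open>points_eqI\<close>).

  The three-term relations that involve the vertices 1 and 2 say that \<open>a (i, j)\<close> is the
  determinant of two vectors \<open>v i\<close>, \<open>v j\<close> of the plane over the field. All these vectors are
  nonzero, since each vertex lies on an edge. So \<open>a (i, j) = 0\<close> means that \<open>v i\<close> and \<open>v j\<close>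
  span the same line. Colouring each vertex by the line that its vector spans
  (\<open>frieze_colouring\<close>), one arrives at a purely combinatorial question: the polygon is coloured
  so that the ends of each edge differ, and the point is deep exactly if no triangulation has the
  property that the ends of each of its diagonals differ.

  If at least three colours occur, such a triangulation exists
  (\<open>three_coloured_polygon_triangulation\<close>): there are three consecutive vertices of different
  colours; if the middle one is the only vertex of its colour, take the fan of all diagonals at
  that vertex, and otherwise cut that vertex off and continue by induction with the smaller
  polygon, which still has three colours. So at a deep point only two colours occur, they
  alternate around the polygon, and \<open>a (i, i + 2) = 0\<close> for all \<open>i\<close>. The Pluecker relation for
  \<open>i, i + 1, i + 2, j\<close> then becomes \<open>a (i, j) = - a (i + 2, j)\<close>, which determines all the values:
  \<open>a (i, j)\<close> is the sequence \<open>0, 1, 0, -1, ...\<close> at \<open>j - i\<close> (\<open>deep_frieze_value\<close>). The only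
  condition left is that the edge joining 1 and \<open>N\<close> has value 1, and it holds exactly in the
  stated cases (\<open>quarter_sine_closing\<close>).

  Conversely that table satisfies the Pluecker relations by an identity for sines, and it is deep
  because each triangulation has a diagonal that cuts off a single vertex
  (\<open>triangulation_has_short_diagonal\<close>), where the value is 0.
\<close>

section \<open>Coloured triangulations of polygons with arbitrary vertex sets\<close>

text \<open>The induction cuts off vertices, so the vertex set of a polygon has to be an arbitrary finite
  set of numbers. Asking for a vertex strictly on each side of \<open>(i, j)\<close> treats the side that joins
  the least and the greatest vertex like all the other sides.\<close>

definition chords :: "nat set \<Rightarrow> (nat \<times> nat) set" where
  "chords S = {(i, j). i \<in> S \<and> j \<in> S \<and> i < j \<and> (\<exists>k\<in>S. i < k \<and> k < j) \<and> (\<exists>k\<in>S. k < i \<or> j < k)}"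

definition triangulates :: "(nat \<times> nat) set \<Rightarrow> nat set \<Rightarrow> bool" where
  "triangulates T S \<longleftrightarrow> T \<subseteq> chords S \<and> noncrossing T \<and> (\<forall>d \<in> chords S - T. \<exists>e\<in>T. crosses d e)"

definition proper_on :: "(nat \<Rightarrow> 'c) \<Rightarrow> (nat \<times> nat) set \<Rightarrow> bool" where
  "proper_on f E \<longleftrightarrow> (\<forall>(i, j) \<in> E. f i \<noteq> f j)"

definition sides :: "nat set \<Rightarrow> (nat \<times> nat) set" where
  "sides S = {(i, j). i \<in> S \<and> j \<in> S \<and> i < j} - chords S"

lemma chords_polygon: "chords {1..N} = diagonals N"
proof -
  have "(i, j) \<in> chords {1..N} \<longleftrightarrow> (i, j) \<in> diagonals N" for i j
  proof
    assume "(i, j) \<in> diagonals N"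
    then have *: "1 \<le> i" "i < j" "j \<le> N" "j \<noteq> i + 1" "\<not> (i = 1 \<and> j = N)"
      by (auto simp: diagonals_def segments_def edges_def)
    then have "i + 1 \<in> {1..N}" "i < i + 1" "i + 1 < j"
      by auto
    moreover have "\<exists>k\<in>{1..N}. k < i \<or> j < k"
      using * by (cases "i = 1") (auto intro: bexI[of _ N] bexI[of _ 1])
    ultimately show "(i, j) \<in> chords {1..N}"
      using * unfolding chords_def by auto
  qed (auto simp: chords_def diagonals_def segments_def edges_def)
  then show ?thesis by auto
qed

lemma sides_polygon: "sides {1..N} = edges N"
  unfolding sides_def chords_polygon
  by (auto simp: diagonals_def segments_def edges_def)

lemma triangulates_imp_triangulation:
  assumes "triangulates T {1..N}"
  shows "T \<in> triangulations N"
  using assms unfolding triangulates_def triangulations_def noncrossing_def chords_polygon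
  by blast

text \<open>A chord that avoids \<open>v\<close> has a vertex on the side opposite to \<open>v\<close>; the segment from there to
  \<open>v\<close> crosses it and is itself a chord, because the two ends of the crossed chord lie on
  different sides of it.\<close>

lemma fan_triangulates:
  assumes v: "v \<in> S"
  shows "triangulates {d \<in> chords S. fst d = v \<or> snd d = v} S"
  unfolding triangulates_def
proof (intro conjI ballI)
  show "noncrossing {d \<in> chords S. fst d = v \<or> snd d = v}"
    unfolding noncrossing_def by auto
  fix d assume d: "d \<in> chords S - {d \<in> chords S. fst d = v \<or> snd d = v}"
  obtain i j where ij: "d = (i, j)" by (cases d)
  from d have *: "i \<in> S" "j \<in> S" "i < j" "i \<noteq> v" "j \<noteq> v"
    "\<exists>k\<in>S. i < k \<and> k < j" "\<exists>k\<in>S. k < i \<or> j < k"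
    unfolding ij chords_def by auto
  show "\<exists>e\<in>{d \<in> chords S. fst d = v \<or> snd d = v}. crosses d e"
  proof (cases "i < v \<and> v < j")
    case True
    then obtain k where k: "k \<in> S" "k < i \<or> j < k" using * by blast
    then have "(min v k, max v k) \<in> chords S"
      using v True * unfolding chords_def
      by (cases "k < i") (auto simp: min_def max_def)
    then show ?thesis
      using True k by (intro bexI[of _ "(min v k, max v k)"]) (auto simp: ij min_def max_def)
  next
    case False
    then obtain k where k: "k \<in> S" "i < k" "k < j" using * by blast
    then have "(min v k, max v k) \<in> chords S"
      using v False * unfolding chords_def
      by (cases "v < i") (auto simp: min_def max_def)
    then show ?thesis
      using False k * by (intro bexI[of _ "(min v k, max v k)"]) (auto simp: ij min_def max_def)
  qed
qed auto

text \<open>The converse of cutting off the ear \<open>v\<close>, whose neighbours are \<open>a\<close> and \<open>b\<close>. A chord that ends in \<open>v\<close>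
  crosses \<open>(a, b)\<close>. Any other chord is a chord of the smaller polygon, except for \<open>(a, b)\<close>, which
  has become a side of it. The vertex \<open>w\<close> witnesses that the larger polygon is not just the
  triangle, so that \<open>(a, b)\<close> is a chord.\<close>

lemma ear_triangulates:
  assumes S: "a \<in> S" "v \<in> S" "b \<in> S" "a < v" "v < b"
    and ear: "\<And>x. x \<in> S \<Longrightarrow> a < x \<Longrightarrow> x < b \<Longrightarrow> x = v"
    and out: "w \<in> S" "w < a \<or> b < w"
    and T: "triangulates T (S - {v})"
  shows "triangulates (insert (a, b) T) S"
  unfolding triangulates_def
proof (intro conjI ballI)
  have sub: "chords (S - {v}) \<subseteq> chords S"
    unfolding chords_def by auto
  have T': "T \<subseteq> chords (S - {v})" "noncrossing T"
    "\<And>d. d \<in> chords (S - {v}) \<Longrightarrow> d \<notin> T \<Longrightarrow> \<exists>e\<in>T. crosses d e"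
    using T unfolding triangulates_def by auto
  have "(a, b) \<in> chords S"
    using S out unfolding chords_def by auto
  then show "insert (a, b) T \<subseteq> chords S"
    using T' sub by auto
  have nc: "\<not> crosses (a, b) d \<and> \<not> crosses d (a, b)" if "d \<in> T" for d
  proof -
    obtain i j where ij: "d = (i, j)" by (cases d)
    then have "i \<in> S - {v}" "j \<in> S - {v}"
      using that T' unfolding chords_def by auto
    then show ?thesis using ear[of i] ear[of j] unfolding ij by auto
  qed
  then show "noncrossing (insert (a, b) T)"
    using T'(2) unfolding noncrossing_def by auto
  fix d assume d: "d \<in> chords S - insert (a, b) T"
  obtain i j where ij: "d = (i, j)" by (cases d)
  from d have *: "i \<in> S" "j \<in> S" "i < j" "\<exists>k\<in>S. i < k \<and> k < j" "\<exists>k\<in>S. k < i \<or> j < k"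
     "(i, j) \<noteq> (a, b)"
    unfolding ij chords_def by auto
  show "\<exists>e\<in>insert (a, b) T. crosses d e"
  proof (cases "i = v \<or> j = v")
    case True
    have "crosses d (a, b)"
    proof (cases "i = v")
      case True
      moreover have "j > b" using * S ear unfolding True
        by (metis linorder_neqE_nat order_less_trans less_asym)
      ultimately show ?thesis using S unfolding ij by auto
    next
      case False
      with True have "j = v" by simp
      moreover have "i < a" using * S ear unfolding \<open>j = v\<close>
        by (metis linorder_neqE_nat order_less_trans less_asym)
      ultimately show ?thesis using S unfolding ij by auto
    qed
    then show ?thesis by blast
  next
    case False
    have "\<exists>k\<in>S - {v}. i < k \<and> k < j"
    proof (rule ccontr)
      assume "\<not> ?thesis"
      then have none: "\<And>k. k \<in> S \<Longrightarrow> i < k \<Longrightarrow> k < j \<Longrightarrow> k = v" by auto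
      then have v: "i < v" "v < j" using * by auto
      have "i = a" using none[of a] ear[of i] v * S by force
      moreover have "j = b" using none[of b] ear[of j] v * S by force
      ultimately show False using * by simp
    qed
    moreover have "\<exists>k\<in>S - {v}. k < i \<or> j < k"
    proof -
      obtain k where k: "k \<in> S" "k < i \<or> j < k" using * by blast
      then show ?thesis
        using S by (cases "k = v") (auto intro: order_less_trans)
    qed
    ultimately have "d \<in> chords (S - {v})"
      using * False unfolding ij chords_def by auto
    then show ?thesis using T'(3) d by blast
  qed
qed

text \<open>Cutting off the ear \<open>v\<close> creates only one new side, namely \<open>(a, b)\<close>.\<close>

lemma proper_sides_remove:
  assumes S: "a \<in> S" "v \<in> S" "b \<in> S" "a < v" "v < b"
    and ear: "\<And>x. x \<in> S \<Longrightarrow> a < x \<Longrightarrow> x < b \<Longrightarrow> x = v"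
    and sides: "proper_on f (sides S)" and ab: "f a \<noteq> f b"
  shows "proper_on f (sides (S - {v}))"
  unfolding proper_on_def
proof (clarify)
  fix i j assume ij: "(i, j) \<in> sides (S - {v})" and eq: "f i = f j"
  then have *: "i \<in> S" "j \<in> S" "i \<noteq> v" "j \<noteq> v" "i < j" "(i, j) \<notin> chords (S - {v})"
    unfolding sides_def by auto
  have "(i, j) \<in> chords S"
    using sides eq * unfolding sides_def proper_on_def by auto
  then have c: "\<exists>k\<in>S. i < k \<and> k < j" "\<exists>k\<in>S. k < i \<or> j < k" unfolding chords_def by auto
  have "\<exists>k\<in>S - {v}. k < i \<or> j < k"
  proof -
    obtain k where k: "k \<in> S" "k < i \<or> j < k" using c by blast
    then show ?thesis
      using S by (cases "k = v") (auto intro: order_less_trans)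
  qed
  then have none: "\<And>k. k \<in> S \<Longrightarrow> i < k \<Longrightarrow> k < j \<Longrightarrow> k = v"
    using * unfolding chords_def by auto
  then have v: "i < v" "v < j" using c(1) by auto
  have "i = a" using none[of a] ear[of i] v * S by force
  moreover have "j = b" using none[of b] ear[of j] v * S by force
  ultimately show False using ab eq by simp
qed

text \<open>Going through the vertices in increasing order, let \<open>b\<close> be the first one at which a third colour
  shows up. Its two predecessors then have the other two colours: they differ from \<open>b\<close> because the
  colour of \<open>b\<close> is new, and from each other because they form a side. So no wrapping around from
  the last vertex to the first is needed.\<close>

lemma three_colours_consecutive:
  fixes S :: "nat set"
  assumes fin: "finite S" and col: "3 \<le> card (f ` S)"
    and sides: "proper_on f (sides S)"
  obtains a v b where "a \<in> S" "v \<in> S" "b \<in> S" "a < v" "v < b"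
    "\<And>x. x \<in> S \<Longrightarrow> a < x \<Longrightarrow> x < b \<Longrightarrow> x = v" "f a \<noteq> f v" "f v \<noteq> f b" "f a \<noteq> f b"
proof -
  have neq: "f i \<noteq> f j" if "i \<in> S" "j \<in> S" "i < j" "\<And>x. x \<in> S \<Longrightarrow> \<not> (i < x \<and> x < j)" for i j
    using sides that unfolding proper_on_def sides_def chords_def by auto
  define P where "P b \<longleftrightarrow> 3 \<le> card (f ` {x \<in> S. x \<le> b})" for b
  define b where "b = (LEAST b. P b)"
  have "{x \<in> S. x \<le> Max S} = S" using fin by auto
  then have "P (Max S)" using col unfolding P_def by simp
  then have Pb: "P b" and least: "\<And>c. c < b \<Longrightarrow> \<not> P c"
    unfolding b_def by (auto intro: LeastI dest: not_less_Least)
  define L where "L = {x \<in> S. x < b}"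
  have finL: "finite L" using fin unfolding L_def by auto
  have L2: "card (f ` L) \<le> 2"
  proof (cases "b = 0")
    case False
    then have "L = {x \<in> S. x \<le> b - 1}" unfolding L_def by auto
    then show ?thesis using least[of "b - 1"] False unfolding P_def by auto
  qed (simp add: L_def)
  have bS: "b \<in> S"
  proof (rule ccontr)
    assume "b \<notin> S"
    then have "{x \<in> S. x \<le> b} = L" unfolding L_def by (auto simp: le_less)
    then show False using Pb L2 unfolding P_def by simp
  qed
  then have le: "{x \<in> S. x \<le> b} = insert b L" unfolding L_def by auto
  have new: "f b \<notin> f ` L"
    using Pb L2 unfolding P_def le by (auto simp: insert_absorb)
  then have cL: "card (f ` L) = 2"
    using Pb L2 finL unfolding P_def le by simp
  define v where "v = Max L"
  have "L \<noteq> {}" using cL by auto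
  then have v: "v \<in> L" "\<And>x. x \<in> L \<Longrightarrow> x \<le> v" unfolding v_def using finL by auto
  define L' where "L' = L - {v}"
  have "L' \<noteq> {}"
  proof
    assume "L' = {}"
    then have "L = {v}" using v unfolding L'_def by auto
    then show False using cL by simp
  qed
  define a where "a = Max L'"
  have a: "a \<in> L'" "\<And>x. x \<in> L' \<Longrightarrow> x \<le> a"
    unfolding a_def using finL \<open>L' \<noteq> {}\<close> Max_in[of L'] Max_ge[of L'] by (simp_all add: L'_def)
  have av: "a < v" using v(2)[of a] a(1) unfolding L'_def by auto
  have ord: "a \<in> S" "v \<in> S" "v < b" using a v unfolding L'_def L_def by auto
  have ear: "x = v" if "x \<in> S" "a < x" "x < b" for x
    using that a(2)[of x] unfolding L'_def L_def by auto
  have "f a \<noteq> f v" by (rule neq) (use av ord ear in force)+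
  moreover have "f v \<noteq> f b" using new imageI[OF v(1), of f] by metis
  moreover have "f a \<noteq> f b" using new imageI[of a L f] a(1) unfolding L'_def by (metis DiffD1)
  ultimately show ?thesis using that ord av bS ear by blast
qed

text \<open>Among three consecutive vertices of different colours, the middle one \<open>v\<close> can be cut off without
  losing a colour unless it is the only vertex of its colour; in that case every diagonal at \<open>v\<close> is
  properly coloured and the fan at \<open>v\<close> will do.\<close>

lemma three_coloured_polygon_triangulation:
  assumes "finite S" "3 \<le> card (f ` S)" "proper_on f (sides S)"
  shows "\<exists>T. triangulates T S \<and> proper_on f T"
  using assms
proof (induction "card S" arbitrary: S rule: less_induct)
  case less
  obtain a v b where S: "a \<in> S" "v \<in> S" "b \<in> S" "a < v" "v < b"
    and ear: "\<And>x. x \<in> S \<Longrightarrow> a < x \<Longrightarrow> x < b \<Longrightarrow> x = v"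
    and f: "f a \<noteq> f v" "f v \<noteq> f b" "f a \<noteq> f b"
    using three_colours_consecutive[OF less.prems] by blast
  show ?case
  proof (cases "f v \<in> f ` (S - {v})")
    case False
    then have uniq: "f x \<noteq> f v" if "x \<in> S" "x \<noteq> v" for x
      using that imageI[of x "S - {v}" f] by (metis Diff_iff singletonD)
    have "f i \<noteq> f j" if "(i, j) \<in> chords S" "i = v \<or> j = v" for i j
      using that uniq[of i] uniq[of j] unfolding chords_def by auto
    then have "proper_on f {d \<in> chords S. fst d = v \<or> snd d = v}"
      unfolding proper_on_def by auto
    then show ?thesis using fan_triangulates[OF S(2)] by blast
  next
    case True
    then obtain w where w: "w \<in> S" "w \<noteq> v" "f w = f v" by force
    then have out: "w < a \<or> b < w" using ear[of w] f by (metis linorder_neqE_nat)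
    have "f ` (S - {v}) = f ` S" using True S(2) by auto
    then obtain T where T: "triangulates T (S - {v})" "proper_on f T"
      using less.hyps[of "S - {v}"] less.prems S card_Diff1_less[of S v]
        proper_sides_remove[OF S ear less.prems(3) f(3)] by auto
    have "triangulates (insert (a, b) T) S"
      by (rule ear_triangulates[OF S ear w(1) out T(1)])
    moreover have "proper_on f (insert (a, b) T)"
      using T(2) f unfolding proper_on_def by auto
    ultimately show ?thesis by blast
  qed
qed

text \<open>Let \<open>(i, j)\<close> be a shortest diagonal of the triangulation. If it did not cut off a single vertex,
  then \<open>(i + 1, j)\<close> would be a diagonal too, and by maximality some member of the triangulation
  would cross it. A diagonal that crosses \<open>(i + 1, j)\<close> but not \<open>(i, j)\<close> starts in \<open>i\<close> and ends
  before \<open>j\<close>, hence is shorter than \<open>(i, j)\<close>.\<close>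

lemma triangulation_has_short_diagonal:
  assumes N: "4 \<le> N" and T: "T \<in> triangulations N"
  obtains i where "(i, i + 2) \<in> T" 
proof -
  have TD: "T \<subseteq> diagonals N" and nc: "noncrossing T"
    and max: "\<And>d. d \<in> diagonals N \<Longrightarrow> d \<notin> T \<Longrightarrow> \<not> noncrossing (insert d T)"
    using T unfolding triangulations_def by auto
  have "(1, 3) \<in> diagonals N"
    using N by (auto simp: diagonals_def segments_def edges_def)
  then have "T \<noteq> {}"
    using max[of "(1, 3)"] by (auto simp: noncrossing_def)
  then obtain d where d: "d \<in> T" "\<And>e. e \<in> T \<Longrightarrow> snd d - fst d \<le> snd e - fst e"
    using ex_has_least_nat[of "\<lambda>d. d \<in> T" _ "\<lambda>d. snd d - fst d"] by blast
  obtain i j where ij: "d = (i, j)" by (cases d)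
  have D: "1 \<le> i" "i < j" "j \<le> N" "j \<noteq> i + 1"
    using d TD unfolding ij by (auto simp: diagonals_def segments_def edges_def)
  have short: "j - i \<le> l - k" if "(k, l) \<in> T" for k l
    using d(2)[OF that] unfolding ij by simp
  have "j = i + 2"
  proof (rule ccontr)
    assume "j \<noteq> i + 2"
    with D have new: "(i + 1, j) \<in> diagonals N"
      by (auto simp: diagonals_def segments_def edges_def)
    have "(i + 1, j) \<notin> T" using short[of "i + 1" j] D by auto
    then have "\<not> noncrossing (insert (i + 1, j) T)" using max[OF new] by blast
    then obtain e where e: "e \<in> T" "crosses (i + 1, j) e \<or> crosses e (i + 1, j)"
      using nc unfolding noncrossing_def by auto
    obtain k l where kl: "e = (k, l)" by (cases e)
    have "\<not> crosses (i, j) (k, l)" using nc d e unfolding noncrossing_def ij kl by blast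
    moreover have "k < l" using e TD unfolding kl by (auto simp: diagonals_def segments_def)
    ultimately have "k = i \<and> l < j" using e(2) unfolding kl by auto
    then show False using short[of k l] e(1) \<open>k < l\<close> unfolding kl by auto
  qed
  then show ?thesis using that[of i] d unfolding ij by simp
qed

section \<open>Evaluation of integer polynomials\<close>

definition monomial_eval :: "('e \<Rightarrow> 'k::comm_ring_1) \<Rightarrow> ('e \<Rightarrow>\<^sub>0 nat) \<Rightarrow> 'k" where
  "monomial_eval a m = (\<Prod>e\<in>Poly_Mapping.keys m. a e ^ Poly_Mapping.lookup m e)"

definition poly_eval :: "('e \<Rightarrow> 'k::comm_ring_1) \<Rightarrow> (('e \<Rightarrow>\<^sub>0 nat) \<Rightarrow>\<^sub>0 int) \<Rightarrow> 'k" where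
  "poly_eval a f =
     (\<Sum>m\<in>Poly_Mapping.keys f. of_int (Poly_Mapping.lookup f m) * monomial_eval a m)"

lemma monomial_eval_add: "monomial_eval a (m + m') = monomial_eval a m * monomial_eval a m'"
proof -
  let ?A = "Poly_Mapping.keys m \<union> Poly_Mapping.keys m'"
  have *: "monomial_eval a x = (\<Prod>e\<in>?A. a e ^ Poly_Mapping.lookup x e)"
    if "Poly_Mapping.keys x \<subseteq> ?A" for x
    unfolding monomial_eval_def using that
    by (intro prod.mono_neutral_left) (auto simp: in_keys_iff)
  show ?thesis
    using Poly_Mapping.keys_add[of m m']
    by (subst (1 2 3) *) (auto simp: lookup_add power_add prod.distrib)
qed

lemma poly_eval_add: "poly_eval a (f + g) = poly_eval a f + poly_eval a g"
  unfolding poly_eval_def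
  by (rule setsum_keys_plus_distrib[of "\<lambda>m c. of_int c * monomial_eval a m"])
    (simp_all add: algebra_simps)

lemma poly_eval_single: "poly_eval a (Poly_Mapping.single m c) = of_int c * monomial_eval a m"
  by (simp add: poly_eval_def)

lemma poly_eval_0: "poly_eval a 0 = 0"
  by (simp add: poly_eval_def)

lemma poly_eval_diff: "poly_eval a (f - g) = poly_eval a f - poly_eval a g"
  using poly_eval_add[of a "f - g" g] by simp

lemma poly_eval_1: "poly_eval a 1 = 1"
  by (simp add: poly_eval_def monomial_eval_def)

lemma poly_eval_var: "poly_eval a (var e) = a e"
  unfolding var_def poly_eval_single by (simp add: monomial_eval_def)

text \<open>Both sides are additive in each factor, so it suffices to compare them on monomials.\<close>

lemma poly_eval_mult: "poly_eval a (f * g) = poly_eval a f * poly_eval a g"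
proof (induction f rule: frag_induction[OF order.refl])
  case (2 m)
  show ?case
    by (induction g rule: frag_induction[OF order.refl])
      (simp_all add: poly_eval_0 poly_eval_diff right_diff_distrib mult_single poly_eval_single
        monomial_eval_add)
qed (simp_all add: poly_eval_0 poly_eval_diff left_diff_distrib)

section \<open>Points of the cluster variety are friezes\<close>

lemma ring_of_type_algebra_simps [simp]:
  "carrier ring_of_type_algebra = UNIV"
  "x \<oplus>\<^bsub>ring_of_type_algebra\<^esub> y = x + y"
  "x \<otimes>\<^bsub>ring_of_type_algebra\<^esub> y = x * y"
  "\<one>\<^bsub>ring_of_type_algebra\<^esub> = 1"
  "\<zero>\<^bsub>ring_of_type_algebra\<^esub> = 0"
  by (simp_all add: ring_of_type_algebra_def)

lemma segment_poly_ring_simps [simp]: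
  "x \<oplus>\<^bsub>segment_poly_ring N\<^esub> y = x + y"
  "x \<otimes>\<^bsub>segment_poly_ring N\<^esub> y = x * y"
  "\<one>\<^bsub>segment_poly_ring N\<^esub> = 1"
  "\<zero>\<^bsub>segment_poly_ring N\<^esub> = 0"
  by (simp_all add: segment_poly_ring_def)

lemma carrier_segment_poly_ring:
  "carrier (segment_poly_ring N) =
     {f. \<forall>m \<in> Poly_Mapping.keys f. Poly_Mapping.keys m \<subseteq> segments N}"
  by (simp add: segment_poly_ring_def)

lemma segment_poly_ring_diff_closed:
  assumes "f \<in> carrier (segment_poly_ring N)" "g \<in> carrier (segment_poly_ring N)"
  shows "f - g \<in> carrier (segment_poly_ring N)"
  using assms keys_diff[of f g] unfolding carrier_segment_poly_ring by blast

lemma poly_eval_ring_hom: "poly_eval a \<in> ring_hom (segment_poly_ring N) ring_of_type_algebra"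
  by (rule ring_hom_memI) (simp_all add: poly_eval_add poly_eval_mult poly_eval_1)

lemma segment_poly_ring_hom_diff:
  fixes \<phi> :: "zpoly \<Rightarrow> 'k::comm_ring_1"
  assumes \<phi>: "\<phi> \<in> ring_hom (segment_poly_ring N) ring_of_type_algebra"
    and fg: "f \<in> carrier (segment_poly_ring N)" "g \<in> carrier (segment_poly_ring N)"
  shows "\<phi> (f - g) = \<phi> f - \<phi> g"
  using ring_hom_add[OF \<phi> segment_poly_ring_diff_closed[OF fg] fg(2)] by simp

text \<open>The polynomials on which the two homomorphisms agree are closed under differences and products
  and contain 1 and the variables, so they contain all monomials and hence everything.\<close>

lemma segment_poly_ring_hom_eqI:
  fixes \<phi> \<psi> :: "zpoly \<Rightarrow> 'k::comm_ring_1"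
  assumes \<phi>: "\<phi> \<in> ring_hom (segment_poly_ring N) ring_of_type_algebra"
    and \<psi>: "\<psi> \<in> ring_hom (segment_poly_ring N) ring_of_type_algebra"
    and eq: "\<And>e. e \<in> segments N \<Longrightarrow> \<phi> (var e) = \<psi> (var e)"
    and f: "f \<in> carrier (segment_poly_ring N)"
  shows "\<phi> f = \<psi> f"
proof -
  interpret R: cring "segment_poly_ring N" by (rule cring_segment_poly_ring)
  define E where "E = {f \<in> carrier (segment_poly_ring N). \<phi> f = \<psi> f}"
  have mult: "f * g \<in> E" if "f \<in> E" "g \<in> E" for f g
    using that R.m_closed[of f g] ring_hom_mult[OF \<phi>, of f g] ring_hom_mult[OF \<psi>, of f g]
    by (simp add: E_def)
  have diff: "f - g \<in> E" if "f \<in> E" "g \<in> E" for f g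
    using that segment_poly_ring_diff_closed[of f N g]
    by (simp add: E_def segment_poly_ring_hom_diff[OF \<phi>] segment_poly_ring_hom_diff[OF \<psi>])
  have one: "1 \<in> E"
    using R.one_closed ring_hom_one[OF \<phi>] ring_hom_one[OF \<psi>] by (simp add: E_def)
  have zero: "0 \<in> E" using diff[OF one one] by simp
  have power: "Poly_Mapping.single (Poly_Mapping.single e b) 1 \<in> E" if "e \<in> segments N" for e b
  proof (induction b)
    case (Suc b)
    have "(Poly_Mapping.single (Poly_Mapping.single e (Suc b)) 1 :: zpoly) =
        var e * Poly_Mapping.single (Poly_Mapping.single e b) 1"
      by (simp add: var_def mult_single flip: single_add)
    moreover have "var e \<in> E" using that eq var_closed by (simp add: E_def)
    ultimately show ?case using mult Suc.IH by simp
  qed (simp add: one)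
  have monom: "Poly_Mapping.keys m \<subseteq> segments N \<Longrightarrow> Poly_Mapping.single m 1 \<in> E" for m
  proof (induction m rule: update_induct)
    case const
    then show ?case by (simp add: one)
  next
    case (update m e b)
    have "Poly_Mapping.update e b m = Poly_Mapping.single e b + m"
      using update.hyps
      by (intro poly_mapping_eqI) (auto simp: lookup_update lookup_add lookup_single in_keys_iff)
    then have "(Poly_Mapping.single (Poly_Mapping.update e b m) 1 :: zpoly) =
        Poly_Mapping.single (Poly_Mapping.single e b) 1 * Poly_Mapping.single m 1"
      by (simp add: mult_single)
    then show ?case
      using update mult power by (auto simp: keys_update)
  qed
  have "f \<in> E"
    by (rule frag_induction[of f "{m. Poly_Mapping.keys m \<subseteq> segments N}"])
      (use f monom zero diff in \<open>auto simp: carrier_segment_poly_ring\<close>)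
  then show ?thesis by (simp add: E_def)
qed

lemma ring_hom_factor_through_quotient:
  assumes I: "ideal I R" and S: "ring S" and h: "h \<in> ring_hom R S" and ker: "I \<subseteq> a_kernel R S h"
  obtains h' where "h' \<in> ring_hom (R Quot I) S" "\<And>x. x \<in> carrier R \<Longrightarrow> h' (I +>\<^bsub>R\<^esub> x) = h x"
proof -
  interpret I: ideal I R by (rule I)
  interpret S: ring S by (rule S)
  interpret h: ring_hom_ring R S h
    by (rule ring_hom_ringI2[OF I.ring_axioms S h])
  define h' where "h' A = the_elem (h ` A)" for A
  have h': "h' (I +>\<^bsub>R\<^esub> x) = h x" if x: "x \<in> carrier R" for x
  proof -
    have "h y = h x" if "y \<in> I +>\<^bsub>R\<^esub> x" for y
    proof -
      from that obtain i where i: "i \<in> I" "y = i \<oplus>\<^bsub>R\<^esub> x"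
        unfolding a_r_coset_def' by auto
      have "i \<in> a_kernel R S h" using i ker by auto
      then have hi: "h i = \<zero>\<^bsub>S\<^esub>" by (rule h.kernel_zero)
      have "i \<in> carrier R" using i(1) by (rule I.a_Hcarr)
      from h.hom_add[OF this x] show ?thesis
        unfolding i(2) hi using S.l_zero[OF h.hom_closed[OF x]] by (rule trans)
    qed
    moreover have "x \<in> I +>\<^bsub>R\<^esub> x" using x I.a_rcos_self by simp
    ultimately have "h ` (I +>\<^bsub>R\<^esub> x) = {h x}" by blast
    then show ?thesis unfolding h'_def by simp
  qed
  have coset: "\<exists>x\<in>carrier R. A = I +>\<^bsub>R\<^esub> x" if "A \<in> carrier (R Quot I)" for A
    using that unfolding FactRing_def A_RCOSETS_def' by auto
  have "h' \<in> ring_hom (R Quot I) S"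
  proof (rule ring_hom_memI)
    show "h' \<one>\<^bsub>R Quot I\<^esub> = \<one>\<^bsub>S\<^esub>"
      using h'[of "\<one>\<^bsub>R\<^esub>"] ring_hom_one[OF I.rcos_ring_hom] by simp
    show "h' A \<in> carrier S" if "A \<in> carrier (R Quot I)" for A
      using coset[OF that] h' by auto
    fix A B assume "A \<in> carrier (R Quot I)" "B \<in> carrier (R Quot I)"
    then obtain x y where xy: "x \<in> carrier R" "A = I +>\<^bsub>R\<^esub> x" "y \<in> carrier R" "B = I +>\<^bsub>R\<^esub> y"
      using coset by meson
    show "h' (A \<otimes>\<^bsub>R Quot I\<^esub> B) = h' A \<otimes>\<^bsub>S\<^esub> h' B" "h' (A \<oplus>\<^bsub>R Quot I\<^esub> B) = h' A \<oplus>\<^bsub>S\<^esub> h' B"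
      using xy h' ring_hom_mult[OF I.rcos_ring_hom, of x y] ring_hom_add[OF I.rcos_ring_hom, of x y]
      by (metis I.m_closed h.hom_mult, metis I.a_closed h.hom_add)
  qed
  with h' that show ?thesis by blast
qed

text \<open>What a ring homomorphism out of the cluster algebra does to the segments. Over a field these
  tables are the tame frieze patterns.\<close>

definition frieze :: "nat \<Rightarrow> (nat \<times> nat \<Rightarrow> 'k::comm_ring_1) \<Rightarrow> bool" where
  "frieze N a \<longleftrightarrow> (\<forall>e\<in>edges N. a e = 1) \<and>
     (\<forall>i j k l. 1 \<le> i \<and> i < j \<and> j < k \<and> k < l \<and> l \<le> N \<longrightarrow>
        a (i, k) * a (j, l) = a (i, j) * a (k, l) + a (i, l) * a (j, k))"

definition to_cluster_algebra :: "nat \<Rightarrow> zpoly \<Rightarrow> zpoly set set" where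
  "to_cluster_algebra n f = edge_ideal (n + 3) +>\<^bsub>pluecker_ring (n + 3)\<^esub>
     (pluecker_ideal (n + 3) +>\<^bsub>segment_poly_ring (n + 3)\<^esub> f)"

lemma to_cluster_algebra_var: "to_cluster_algebra n (var e) = cluster_gen n e"
  by (simp add: to_cluster_algebra_def cluster_gen_def pluecker_gen_def)

lemma pluecker_coset_hom:
  "(+>\<^bsub>segment_poly_ring N\<^esub>) (pluecker_ideal N) \<in> ring_hom (segment_poly_ring N) (pluecker_ring N)"
  unfolding pluecker_ring_def by (rule ideal.rcos_ring_hom[OF ideal_pluecker_ideal])

lemma edge_coset_hom:
  "(+>\<^bsub>pluecker_ring (n + 3)\<^esub>) (edge_ideal (n + 3)) \<in> ring_hom (pluecker_ring (n + 3)) (cluster_algebra_A n)"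
  unfolding cluster_algebra_A_def by (rule ideal.rcos_ring_hom[OF ideal_edge_ideal])

lemma to_cluster_algebra_hom:
  "to_cluster_algebra n \<in> ring_hom (segment_poly_ring (n + 3)) (cluster_algebra_A n)"
  using ring_hom_trans[OF pluecker_coset_hom edge_coset_hom]
  unfolding comp_def to_cluster_algebra_def[abs_def] .

lemma to_cluster_algebra_surj:
  "carrier (cluster_algebra_A n) = to_cluster_algebra n ` carrier (segment_poly_ring (n + 3))"
  unfolding cluster_algebra_A_def to_cluster_algebra_def pluecker_ring_def FactRing_def A_RCOSETS_def'
  by auto

lemma pluecker_relation_vanishes:
  assumes "f \<in> pluecker_relations (n + 3)"
  shows "to_cluster_algebra n f = \<zero>\<^bsub>cluster_algebra_A n\<^esub>"
proof -
  interpret R: cring "segment_poly_ring (n + 3)" by (rule cring_segment_poly_ring)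
  interpret P: cring "pluecker_ring (n + 3)" by (rule cring_pluecker_ring)
  interpret I: ideal "pluecker_ideal (n + 3)" "segment_poly_ring (n + 3)" by (rule ideal_pluecker_ideal)
  interpret J: ideal "edge_ideal (n + 3)" "pluecker_ring (n + 3)" by (rule ideal_edge_ideal)
  have "f \<in> pluecker_ideal (n + 3)"
    using assms R.genideal_self[OF pluecker_relations_closed] unfolding pluecker_ideal_def by blast
  then have "pluecker_ideal (n + 3) +>\<^bsub>segment_poly_ring (n + 3)\<^esub> f = \<zero>\<^bsub>pluecker_ring (n + 3)\<^esub>"
    using I.a_rcos_const by (simp add: pluecker_ring_def FactRing_def)
  then show ?thesis
    using J.a_rcos_const[OF J.zero_closed]
    by (simp add: to_cluster_algebra_def cluster_algebra_A_def FactRing_def)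
qed

lemma cluster_gen_edge:
  assumes e: "e \<in> edges (n + 3)"
  shows "cluster_gen n e = \<one>\<^bsub>cluster_algebra_A n\<^esub>"
proof -
  interpret P: cring "pluecker_ring (n + 3)" by (rule cring_pluecker_ring)
  interpret J: ideal "edge_ideal (n + 3)" "pluecker_ring (n + 3)" by (rule ideal_edge_ideal)
  let ?g = "\<lambda>e. pluecker_gen (n + 3) e"
  have gen: "?g e \<in> carrier (pluecker_ring (n + 3))" if "e \<in> edges (n + 3)" for e
    using that by (intro pluecker_gen_closed) (auto simp: edges_def)
  have "?g e \<ominus>\<^bsub>pluecker_ring (n + 3)\<^esub> \<one>\<^bsub>pluecker_ring (n + 3)\<^esub> \<in> edge_ideal (n + 3)"
    using e gen P.genideal_self[of "(\<lambda>e. ?g e \<ominus>\<^bsub>pluecker_ring (n + 3)\<^esub> \<one>\<^bsub>pluecker_ring (n + 3)\<^esub>) ` edges (n + 3)"]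
    unfolding edge_ideal_def by blast
  then have "edge_ideal (n + 3) +>\<^bsub>pluecker_ring (n + 3)\<^esub> ?g e =
      edge_ideal (n + 3) +>\<^bsub>pluecker_ring (n + 3)\<^esub> \<one>\<^bsub>pluecker_ring (n + 3)\<^esub>"
    using gen[OF e] P.quotient_eq_iff_same_a_r_cos[OF J.ideal_axioms] by simp
  then show ?thesis
    by (simp add: cluster_gen_def cluster_algebra_A_def FactRing_def)
qed

lemma point_comp_hom:
  assumes "p \<in> cluster_variety n"
  shows "p \<circ> to_cluster_algebra n \<in> ring_hom (segment_poly_ring (n + 3)) ring_of_type_algebra"
  using assms ring_hom_trans[OF to_cluster_algebra_hom] unfolding cluster_variety_def by blast

lemma ring_hom_type_algebra_zero:
  fixes h :: "_ \<Rightarrow> 'k::comm_ring_1"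
  assumes "h \<in> ring_hom R ring_of_type_algebra" "ring R"
  shows "h \<zero>\<^bsub>R\<^esub> = 0"
  using ring_hom_zero[OF assms ring_from_type_algebra] by simp

text \<open>The generators of the cluster algebra satisfy the defining relations, and a homomorphism
  preserves them.\<close>

lemma point_frieze:
  fixes p :: "zpoly set set \<Rightarrow> 'k::field"
  assumes p: "p \<in> cluster_variety n"
  shows "frieze (n + 3) (\<lambda>e. p (cluster_gen n e))"
  unfolding frieze_def
proof (intro conjI ballI allI impI)
  have hom: "p \<in> ring_hom (cluster_algebra_A n) ring_of_type_algebra"
    using p unfolding cluster_variety_def by blast
  show "p (cluster_gen n e) = 1" if "e \<in> edges (n + 3)" for e
    using cluster_gen_edge[OF that] ring_hom_one[OF hom] by simp
  fix i j k l assume *: "1 \<le> i \<and> i < j \<and> j < k \<and> k < l \<and> l \<le> n + 3"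
  let ?R = "segment_poly_ring (n + 3)" and ?h = "p \<circ> to_cluster_algebra n"
  interpret R: cring ?R by (rule cring_segment_poly_ring)
  have hom': "?h \<in> ring_hom ?R ring_of_type_algebra" by (rule point_comp_hom[OF p])
  have v: "var e \<in> carrier ?R"
    if "e \<in> {(i, k), (j, l), (i, j), (k, l), (i, l), (j, k)}" for e
    using that * by (intro var_closed) (auto simp: segments_def)
  have vv: "var e * var e' \<in> carrier ?R" "?h (var e * var e') = ?h (var e) * ?h (var e')"
    if "e \<in> {(i, k), (j, l), (i, j), (k, l), (i, l), (j, k)}"
      "e' \<in> {(i, k), (j, l), (i, j), (k, l), (i, l), (j, k)}" for e e'
    using R.m_closed[OF v[OF that(1)] v[OF that(2)]] ring_hom_mult[OF hom' v[OF that(1)] v[OF that(2)]]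
    by simp_all
  have sum: "var (i, j) * var (k, l) + var (i, l) * var (j, k) \<in> carrier ?R"
    "?h (var (i, j) * var (k, l) + var (i, l) * var (j, k)) =
      ?h (var (i, j) * var (k, l)) + ?h (var (i, l) * var (j, k))"
    using R.a_closed[OF vv(1) vv(1), of "(i, j)" "(k, l)" "(i, l)" "(j, k)"]
      ring_hom_add[OF hom' vv(1) vv(1), of "(i, j)" "(k, l)" "(i, l)" "(j, k)"] by simp_all
  have "var (i, k) * var (j, l) - (var (i, j) * var (k, l) + var (i, l) * var (j, k))
      \<in> pluecker_relations (n + 3)"
    unfolding pluecker_relations_def using * by blast
  then have "?h (var (i, k) * var (j, l) - (var (i, j) * var (k, l) + var (i, l) * var (j, k))) = 0"
    using pluecker_relation_vanishes
      ring_hom_type_algebra_zero[OF hom cring.axioms(1)[OF cring_cluster_algebra_A]] by simp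
  then have "?h (var (i, k)) * ?h (var (j, l)) =
      ?h (var (i, j)) * ?h (var (k, l)) + ?h (var (i, l)) * ?h (var (j, k))"
    using segment_poly_ring_hom_diff[OF hom' vv(1) sum(1), of "(i, k)" "(j, l)"] vv(2) sum(2)
    by (simp del: comp_apply)
  then show "p (cluster_gen n (i, k)) * p (cluster_gen n (j, l)) =
      p (cluster_gen n (i, j)) * p (cluster_gen n (k, l)) +
      p (cluster_gen n (i, l)) * p (cluster_gen n (j, k))"
    by (simp add: to_cluster_algebra_var)
qed

text \<open>The images of the variables generate the cluster algebra.\<close>

lemma points_eqI:
  fixes p q :: "zpoly set set \<Rightarrow> 'k::field"
  assumes p: "p \<in> cluster_variety n" and q: "q \<in> cluster_variety n"
    and eq: "\<And>e. e \<in> segments (n + 3) \<Longrightarrow> p (cluster_gen n e) = q (cluster_gen n e)"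
  shows "p = q"
proof (rule extensionalityI)
  show "p \<in> extensional (carrier (cluster_algebra_A n))"
    "q \<in> extensional (carrier (cluster_algebra_A n))"
    using p q unfolding cluster_variety_def by auto
  fix x assume "x \<in> carrier (cluster_algebra_A n)"
  then obtain f where f: "f \<in> carrier (segment_poly_ring (n + 3))" "x = to_cluster_algebra n f"
    unfolding to_cluster_algebra_surj by auto
  show "p x = q x"
    using segment_poly_ring_hom_eqI[OF point_comp_hom[OF p] point_comp_hom[OF q] _ f(1)] eq
    by (simp add: to_cluster_algebra_var f(2))
qed

text \<open>Evaluation at \<open>a\<close> kills the Pluecker relations, so it factors through the first quotient; the
  induced map sends the generators of the edges to 1, so it factors through the second quotient.
  Restricting to the carrier makes the resulting homomorphism an element of the variety.\<close>

lemma frieze_point: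
  fixes a :: "nat \<times> nat \<Rightarrow> 'k::field"
  assumes a: "frieze (n + 3) a"
  obtains p where "p \<in> cluster_variety n"
    "\<And>e. e \<in> segments (n + 3) \<Longrightarrow> p (cluster_gen n e) = a e"
proof -
  let ?R = "segment_poly_ring (n + 3)" and ?P = "pluecker_ring (n + 3)"
  let ?K = "ring_of_type_algebra :: 'k ring"
  have K: "ring ?K" by (rule ring_from_type_algebra)
  interpret R: cring ?R by (rule cring_segment_poly_ring)
  interpret P: cring ?P by (rule cring_pluecker_ring)
  interpret ev: ring_hom_ring ?R ?K "poly_eval a"
    by (rule ring_hom_ringI2[OF R.ring_axioms K poly_eval_ring_hom])
  have "pluecker_relations (n + 3) \<subseteq> a_kernel ?R ?K (poly_eval a)"
  proof
    fix f assume f: "f \<in> pluecker_relations (n + 3)"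
    then have "poly_eval a f = 0"
      using a unfolding pluecker_relations_def frieze_def
      by (force simp: poly_eval_diff poly_eval_add poly_eval_mult poly_eval_var)
    moreover have "f \<in> carrier ?R" using f pluecker_relations_closed by blast
    ultimately show "f \<in> a_kernel ?R ?K (poly_eval a)"
      unfolding a_kernel_def' ring_of_type_algebra_simps by blast
  qed
  then have "pluecker_ideal (n + 3) \<subseteq> a_kernel ?R ?K (poly_eval a)"
    unfolding pluecker_ideal_def by (intro R.genideal_minimal ev.kernel_is_ideal)
  then obtain h where h: "h \<in> ring_hom ?P ?K"
    "\<And>f. f \<in> carrier ?R \<Longrightarrow> h (pluecker_ideal (n + 3) +>\<^bsub>?R\<^esub> f) = poly_eval a f"
    using ring_hom_factor_through_quotient[OF ideal_pluecker_ideal K poly_eval_ring_hom]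
    unfolding pluecker_ring_def by metis
  have hgen: "h (pluecker_gen (n + 3) e) = a e" if "e \<in> segments (n + 3)" for e
    using h(2)[OF var_closed[OF that]] unfolding pluecker_gen_def by (simp add: poly_eval_var)
  interpret h: ring_hom_ring ?P ?K h
    by (rule ring_hom_ringI2[OF P.ring_axioms K h(1)])
  have "(\<lambda>e. pluecker_gen (n + 3) e \<ominus>\<^bsub>?P\<^esub> \<one>\<^bsub>?P\<^esub>) ` edges (n + 3) \<subseteq> a_kernel ?P ?K h"
  proof clarify
    fix i j assume e: "(i, j) \<in> edges (n + 3)"
    then have s: "(i, j) \<in> segments (n + 3)" unfolding edges_def by auto
    let ?g = "pluecker_gen (n + 3) (i, j)"
    have g: "?g \<in> carrier ?P" by (rule pluecker_gen_closed[OF s])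
    have "h (?g \<ominus>\<^bsub>?P\<^esub> \<one>\<^bsub>?P\<^esub>) + h \<one>\<^bsub>?P\<^esub> = h ?g"
      using g ring_hom_add[OF h(1), of "?g \<ominus>\<^bsub>?P\<^esub> \<one>\<^bsub>?P\<^esub>" "\<one>\<^bsub>?P\<^esub>"]
      by (simp add: P.minus_eq P.a_assoc P.l_neg)
    moreover have "h ?g = 1" using hgen[OF s] a e unfolding frieze_def by auto
    ultimately have "h (?g \<ominus>\<^bsub>?P\<^esub> \<one>\<^bsub>?P\<^esub>) = 0" using ring_hom_one[OF h(1)] by simp
    then show "?g \<ominus>\<^bsub>?P\<^esub> \<one>\<^bsub>?P\<^esub> \<in> a_kernel ?P ?K h"
      using g P.minus_closed[OF g P.one_closed]
      unfolding a_kernel_def' ring_of_type_algebra_simps by blast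
  qed
  then have "edge_ideal (n + 3) \<subseteq> a_kernel ?P ?K h"
    unfolding edge_ideal_def by (intro P.genideal_minimal h.kernel_is_ideal)
  then obtain p where p: "p \<in> ring_hom (cluster_algebra_A n) ?K"
    "\<And>x. x \<in> carrier ?P \<Longrightarrow> p (edge_ideal (n + 3) +>\<^bsub>?P\<^esub> x) = h x"
    using ring_hom_factor_through_quotient[OF ideal_edge_ideal K h(1)]
    unfolding cluster_algebra_A_def by metis
  interpret A: cring "cluster_algebra_A n" by (rule cring_cluster_algebra_A)
  let ?p = "restrict p (carrier (cluster_algebra_A n))"
  have "?p \<in> cluster_variety n"
    unfolding cluster_variety_def using A.ring_hom_restrict[OF p(1), of ?p] by auto
  moreover have "?p (cluster_gen n e) = a e" if "e \<in> segments (n + 3)" for e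
    using cluster_gen_closed[OF that] p(2)[OF pluecker_gen_closed[OF that]] hgen[OF that]
    by (simp add: cluster_gen_def)
  ultimately show ?thesis using that by blast
qed

section \<open>The alternating frieze\<close>

text \<open>This is \<open>sin (\<pi> d / 2)\<close>, which takes only the values 0, 1 and -1 and so makes sense in any ring.\<close>

fun quarter_sine :: "nat \<Rightarrow> 'k::comm_ring_1" where
  "quarter_sine 0 = 0"
| "quarter_sine (Suc 0) = 1"
| "quarter_sine (Suc (Suc d)) = - quarter_sine d"

lemma quarter_sine_closed_form:
  "quarter_sine d = (if odd d then (- 1) ^ ((d - 1) div 2) else 0)"
proof (induction d rule: quarter_sine.induct)
  case (3 d)
  then show ?case by (cases d) auto
qed auto

lemma quarter_sine_shift: "quarter_sine (2 * m + d) = (- 1) ^ m * quarter_sine d"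
  by (induction m) auto

text \<open>The identity \<open>sin (x + y) sin (y + z) = sin x sin z + sin (x + y + z) sin y\<close> at multiples of a right
  angle. Splitting off multiples of two right angles changes both sides by the same sign and leaves
  eight cases.\<close>

lemma quarter_sine_pluecker:
  "quarter_sine (p + q) * quarter_sine (q + r) =
     (quarter_sine p * quarter_sine r + quarter_sine (p + q + r) * quarter_sine q :: 'k::comm_ring_1)"
proof -
  define p' q' r' where "p' = p div 2" "q' = q div 2" "r' = r div 2"
  define e f g where "e = p mod 2" "f = q mod 2" "g = r mod 2"
  let ?s = "quarter_sine :: nat \<Rightarrow> 'k"
  have pqr: "p = 2 * p' + e" "q = 2 * q' + f" "r = 2 * r' + g"
    unfolding p'_q'_r'_def e_f_g_def by simp_all
  then have "p + q = 2 * (p' + q') + (e + f)" "q + r = 2 * (q' + r') + (f + g)"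
    "p + q + r = 2 * (p' + q' + r') + (e + f + g)"
    by simp_all
  then have shift: "?s (p + q) = (- 1) ^ (p' + q') * ?s (e + f)"
    "?s (q + r) = (- 1) ^ (q' + r') * ?s (f + g)"
    "?s (p + q + r) = (- 1) ^ (p' + q' + r') * ?s (e + f + g)"
    "?s p = (- 1) ^ p' * ?s e" "?s q = (- 1) ^ q' * ?s f" "?s r = (- 1) ^ r' * ?s g"
    using pqr by (metis quarter_sine_shift)+
  have sq: "(- 1) ^ q' * (- 1) ^ q' = (1 :: 'k)"
    by (simp flip: power_mult_distrib)
  have "e = 0 \<or> e = 1" "f = 0 \<or> f = 1" "g = 0 \<or> g = 1"
    unfolding e_f_g_def by auto
  then have small: "?s (e + f) * ?s (f + g) = ?s e * ?s g + ?s (e + f + g) * ?s f"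
    by (elim disjE) (simp_all add: numeral_2_eq_2 numeral_3_eq_3)
  have "?s (p + q) * ?s (q + r) =
      ((- 1) ^ q' * (- 1) ^ q') * ((- 1) ^ p' * (- 1) ^ r') * (?s (e + f) * ?s (f + g))"
    unfolding shift power_add by (simp only: mult_ac)
  also have "\<dots> = (- 1) ^ p' * (- 1) ^ r' * (?s e * ?s g)
      + ((- 1) ^ q' * (- 1) ^ q') * ((- 1) ^ p' * (- 1) ^ r') * (?s (e + f + g) * ?s f)"
    unfolding sq small by (simp only: mult_1_left distrib_left)
  also have "\<dots> = ?s p * ?s r + ?s (p + q + r) * ?s q"
    unfolding shift power_add by (simp only: mult_ac)
  finally show ?thesis .
qed

text \<open>Adding 2 to the argument changes the sign, so \<open>quarter_sine (n + 2)\<close> is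
  \<open>- quarter_sine (n mod 4)\<close>, that is 0, -1, 0 or 1; and \<open>-1 = 1\<close> just in characteristic 2.\<close>

lemma quarter_sine_closing:
  "quarter_sine (n + 2) = (1 :: 'k::field) \<longleftrightarrow> n mod 4 = 3 \<or> (n mod 4 = 1 \<and> CHAR('k) = 2)"
proof -
  have "quarter_sine (n + 2) = (- quarter_sine (n mod 4) :: 'k)"
    using quarter_sine_shift[of "2 * (n div 4)" "n mod 4", where 'a = 'k] by simp
  moreover have "n mod 4 = 0 \<or> n mod 4 = 1 \<or> n mod 4 = 2 \<or> n mod 4 = 3" by presburger
  moreover have "(- 1 = (1 :: 'k)) \<longleftrightarrow> CHAR('k) = 2"
  proof
    assume "- 1 = (1 :: 'k)"
    then have "1 + 1 = (0 :: 'k)" by (simp only: neg_eq_iff_add_eq_0)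
    then have "of_nat 2 = (0 :: 'k)" by simp
    then have "CHAR('k) dvd 2" by (simp only: of_nat_eq_0_iff_char_dvd)
    then have "CHAR('k) = 1 \<or> CHAR('k) = 2"
      using two_is_prime_nat unfolding prime_nat_iff by blast
    then show "CHAR('k) = 2" using CHAR_not_1[where 'a = 'k] by simp
  qed (simp add: uminus_CHAR_2)
  ultimately show ?thesis by (elim disjE) (simp_all add: numeral_2_eq_2 numeral_3_eq_3)
qed

section \<open>Vanishing of friezes as a colouring of the vertices\<close>

lemma frieze_edge:
  assumes "frieze N a" "1 \<le> i" "i < N"
  shows "a (i, i + 1) = 1"
  using assms unfolding frieze_def by (auto simp: edges_def segments_def)

lemma frieze_last_edge:
  assumes "frieze N a" "2 \<le> N"
  shows "a (1, N) = 1"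
  using assms unfolding frieze_def by (auto simp: edges_def segments_def)

lemma frieze_pluecker:
  assumes "frieze N a" "1 \<le> i" "i < j" "j < k" "k < l" "l \<le> N"
  shows "a (i, k) * a (j, l) = a (i, j) * a (k, l) + a (i, l) * a (j, k)"
  using assms unfolding frieze_def by blast

text \<open>The relation for \<open>1, 2, i, j\<close> reads \<open>a (1, i) * a (2, j) = a (i, j) + a (1, j) * a (2, i)\<close>. Hence
  \<open>a (i, j)\<close> is the determinant of the vectors \<open>(a (1, i), a (2, i))\<close> and \<open>(a (1, j), a (2, j))\<close>. For
  \<open>i = 1\<close> and \<open>i = 2\<close> the vectors are completed by the values \<open>a (1, 1) = a (2, 2) = 0\<close> and
  \<open>a (2, 1) = -1\<close> of an antisymmetric table. The colour of \<open>i\<close> is the line spanned by its vector,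
  encoded by whether the line is vertical and by its slope.\<close>

lemma frieze_colouring:
  fixes a :: "nat \<times> nat \<Rightarrow> 'k::field"
  assumes N: "3 \<le> N" and a: "frieze N a"
  obtains f :: "nat \<Rightarrow> bool \<times> 'k"
  where "\<And>i j. 1 \<le> i \<Longrightarrow> i < j \<Longrightarrow> j \<le> N \<Longrightarrow> a (i, j) = 0 \<longleftrightarrow> f i = f j"
proof -
  define x where "x i = (if i = 1 then 0 else a (1, i))" for i
  define y where "y i = (if i = 1 then - 1 else if i = 2 then 0 else a (2, i))" for i
  have det: "a (i, j) = x i * y j - x j * y i" if ij: "1 \<le> i" "i < j" "j \<le> N" for i j
  proof -
    have a12: "a (1, 2) = 1" using frieze_edge[OF a, of 1] N by (simp add: numeral_2_eq_2)
    consider "i = 1" | "i = 2" | "3 \<le> i" using ij by linarith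
    then show ?thesis
    proof cases
      case 3
      then show ?thesis
        using frieze_pluecker[OF a, of 1 2 i j] ij a12 by (simp add: x_def y_def algebra_simps)
    qed (use ij a12 in \<open>auto simp: x_def y_def\<close>)
  qed
  have nonzero: "x i \<noteq> 0 \<or> y i \<noteq> 0" if i: "1 \<le> i" "i \<le> N" for i
  proof (cases "i = N")
    case True
    moreover have "1 \<le> N - 1" "N - 1 < N" "N - 1 + 1 = N" using N by simp_all
    ultimately show ?thesis
      using det[of "N - 1" N] frieze_edge[OF a, of "N - 1"] by auto
  next
    case False
    then show ?thesis using det[of i "i + 1"] frieze_edge[OF a, of i] i by auto
  qed
  \<comment> \<open>On vertical lines the slope is \<open>y i / 0 = 0\<close>, so all vertical lines get the same colour.\<close>
  show ?thesis
  proof (rule that[of "\<lambda>i. (x i = 0, y i / x i)"])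
    fix i j assume ij: "1 \<le> i" "i < j" "j \<le> N"
    show "a (i, j) = 0 \<longleftrightarrow> (x i = 0, y i / x i) = (x j = 0, y j / x j)"
      using nonzero[of i] nonzero[of j] ij
      by (cases "x i = 0"; cases "x j = 0") (auto simp: det[OF ij] field_simps)
  qed
qed

section \<open>Deep friezes\<close>

definition deep_frieze :: "nat \<Rightarrow> (nat \<times> nat \<Rightarrow> 'k::field) \<Rightarrow> bool" where
  "deep_frieze N a \<longleftrightarrow> frieze N a \<and> (\<forall>T\<in>triangulations N. \<exists>d\<in>T. a d = 0)"

text \<open>A properly coloured triangulation would contradict deepness, so the vertices have only two
  colours. Then \<open>i\<close> and \<open>i + 2\<close>, which both differ in colour from \<open>i + 1\<close>, have the same colour.\<close>

lemma deep_frieze_short_diagonal: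
  fixes a :: "nat \<times> nat \<Rightarrow> 'k::field"
  assumes N: "3 \<le> N" and deep: "deep_frieze N a" and i: "1 \<le> i" "i + 2 \<le> N"
  shows "a (i, i + 2) = 0"
proof -
  have a: "frieze N a" using deep unfolding deep_frieze_def by blast
  obtain f :: "nat \<Rightarrow> bool \<times> 'k"
    where f: "\<And>i j. 1 \<le> i \<Longrightarrow> i < j \<Longrightarrow> j \<le> N \<Longrightarrow> a (i, j) = 0 \<longleftrightarrow> f i = f j"
    using frieze_colouring[OF N a] by blast
  have "proper_on f (sides {1..N})"
    using a f unfolding proper_on_def sides_polygon frieze_def
    by (fastforce simp: edges_def segments_def)
  moreover have "\<not> (\<exists>T. triangulates T {1..N} \<and> proper_on f T)"
  proof clarify
    fix T assume T: "triangulates T {1..N}" "proper_on f T"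
    obtain d where "d \<in> T" "a d = 0"
      using triangulates_imp_triangulation[OF T(1)] deep unfolding deep_frieze_def by blast
    then obtain k l where kl: "(k, l) \<in> T" "a (k, l) = 0" by (cases d) auto
    then have "(k, l) \<in> segments N"
      using T(1) unfolding triangulates_def chords_polygon diagonals_def by auto
    then show False using kl T(2) f[of k l] unfolding proper_on_def segments_def by auto
  qed
  ultimately have two: "card (f ` {1..N}) \<le> 2"
    using three_coloured_polygon_triangulation[of "{1..N}" f] by fastforce
  have "f i \<noteq> f (i + 1)" "f (i + 1) \<noteq> f (i + 2)"
    using f[of i "i + 1"] f[of "i + 1" "i + 2"] frieze_edge[OF a, of i] frieze_edge[OF a, of "i + 1"] i
    by auto
  moreover have "card {f i, f (i + 1), f (i + 2)} \<le> 2"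
    using card_mono[of "f ` {1..N}" "{f i, f (i + 1), f (i + 2)}"] two i by fastforce
  ultimately have "f i = f (i + 2)" by (auto simp: card_insert_if split: if_splits)
  then show ?thesis using f[of i "i + 2"] i by simp
qed

text \<open>As the short diagonals vanish and the edges have value 1, the relation for
  \<open>i, i + 1, i + 2, j\<close> is \<open>0 = a (i + 2, j) + a (i, j)\<close>, the recursion that defines
  \<open>quarter_sine\<close>.\<close>

lemma deep_frieze_value:
  fixes a :: "nat \<times> nat \<Rightarrow> 'k::field"
  assumes N: "3 \<le> N" and deep: "deep_frieze N a" and ij: "1 \<le> i" "i < j" "j \<le> N"
  shows "a (i, j) = quarter_sine (j - i)"
proof -
  have a: "frieze N a" using deep unfolding deep_frieze_def by blast
  have "1 \<le> i \<Longrightarrow> i + d \<le> N \<Longrightarrow> 0 < d \<Longrightarrow> a (i, i + d) = quarter_sine d" for d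
  proof (induction d arbitrary: i rule: quarter_sine.induct)
    case 2
    then show ?case using frieze_edge[OF a, of i] by simp
  next
    case (3 d)
    show ?case
    proof (cases "d = 0")
      case True
      then show ?thesis using deep_frieze_short_diagonal[OF N deep, of i] "3.prems" by simp
    next
      case False
      then have "a (i, i + 2) * a (i + 1, i + 2 + d) =
          a (i, i + 1) * a (i + 2, i + 2 + d) + a (i, i + 2 + d) * a (i + 1, i + 2)"
        using "3.prems" by (intro frieze_pluecker[OF a]) auto
      moreover have "a (i + 1, i + 2) = 1" "a (i, i + 1) = 1"
        using frieze_edge[OF a, of "i + 1"] frieze_edge[OF a, of i] "3.prems" by auto
      moreover have "a (i, i + 2) = 0"
        using deep_frieze_short_diagonal[OF N deep, of i] "3.prems" by simp
      ultimately have "a (i, i + 2 + d) = - a (i + 2, i + 2 + d)"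
        by (simp add: eq_neg_iff_add_eq_0 add.commute)
      then show ?thesis using "3.IH"[of "i + 2"] "3.prems" False by simp
    qed
  qed simp
  from this[of "j - i"] show ?thesis using ij by simp
qed

text \<open>The hypothesis \<open>closing\<close> is the edge condition for the edge that joins 1 and \<open>N\<close>.\<close>

lemma quarter_sine_deep_frieze:
  assumes N: "4 \<le> N" and closing: "quarter_sine (N - 1) = (1 :: 'k::field)"
  shows "deep_frieze N (\<lambda>(i, j). quarter_sine (j - i) :: 'k)"
  unfolding deep_frieze_def frieze_def
proof (intro conjI ballI allI impI)
  fix e assume "e \<in> edges N"
  then show "(\<lambda>(i, j). quarter_sine (j - i) :: 'k) e = 1"
    using closing by (auto simp: edges_def)
next
  fix i j k l assume "1 \<le> i \<and> i < j \<and> j < k \<and> k < l \<and> l \<le> N"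
  then show "(\<lambda>(i, j). quarter_sine (j - i) :: 'k) (i, k) * (\<lambda>(i, j). quarter_sine (j - i)) (j, l) =
      (\<lambda>(i, j). quarter_sine (j - i)) (i, j) * (\<lambda>(i, j). quarter_sine (j - i)) (k, l) +
      (\<lambda>(i, j). quarter_sine (j - i)) (i, l) * (\<lambda>(i, j). quarter_sine (j - i)) (j, k)"
    using quarter_sine_pluecker[of "j - i" "k - j" "l - k", where 'k = 'k] by simp
next
  fix T assume "T \<in> triangulations N"
  then obtain i where "(i, i + 2) \<in> T"
    using triangulation_has_short_diagonal[OF N] by blast
  then show "\<exists>d\<in>T. (\<lambda>(i, j). quarter_sine (j - i) :: 'k) d = 0"
    by (intro bexI[of _ "(i, i + 2)"]) (auto simp: numeral_2_eq_2)
qed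

lemma deep_points_iff:
  "p \<in> deep_points n \<longleftrightarrow>
     p \<in> cluster_variety n \<and> deep_frieze (n + 3) (\<lambda>e. p (cluster_gen n e))"
  unfolding deep_points_def deep_frieze_def using point_frieze by blast

section \<open>The deep points\<close>

theorem theorem3p11:
  fixes n :: nat
  assumes "n \<ge> 1"
  shows
    "(n mod 4 = 3 \<or> (n mod 4 = 1 \<and> CHAR('k::field) = 2) \<longrightarrow>
        (\<exists>p. (deep_points n :: (zpoly set set \<Rightarrow> 'k) set) = {p} \<and>
          (\<forall>(i, j) \<in> diagonals (n + 3).
             p (cluster_gen n (i, j)) =
               (if i mod 2 \<noteq> j mod 2 then (- 1) ^ ((j - i - 1) div 2) else 0)))) \<and>
     (\<not> (n mod 4 = 3 \<or> (n mod 4 = 1 \<and> CHAR('k) = 2)) \<longrightarrow>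
        (deep_points n :: (zpoly set set \<Rightarrow> 'k) set) = {})"
proof -
  let ?s = "\<lambda>(i, j). quarter_sine (j - i) :: 'k"
  have gen_value: "p (cluster_gen n e) = ?s e"
    if p: "p \<in> deep_points n" and e: "e \<in> segments (n + 3)" for p e
    using deep_frieze_value[of "n + 3" "\<lambda>e. p (cluster_gen n e)"] p e
    unfolding deep_points_iff segments_def by auto
  show ?thesis
  proof (intro conjI impI)
    assume "n mod 4 = 3 \<or> (n mod 4 = 1 \<and> CHAR('k) = 2)"
    then have "quarter_sine (n + 2) = (1 :: 'k)" by (simp only: quarter_sine_closing)
    then have deep: "deep_frieze (n + 3) ?s"
      using assms by (intro quarter_sine_deep_frieze) (simp_all add: numeral_3_eq_3 numeral_2_eq_2)
    then obtain p where p: "p \<in> cluster_variety n"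
      "\<And>e. e \<in> segments (n + 3) \<Longrightarrow> p (cluster_gen n e) = ?s e"
      using frieze_point unfolding deep_frieze_def by metis
    have "\<exists>d\<in>T. p (cluster_gen n d) = 0" if T: "T \<in> triangulations (n + 3)" for T
    proof -
      obtain d where d: "d \<in> T" "?s d = 0"
        using deep T unfolding deep_frieze_def by blast
      moreover have "d \<in> segments (n + 3)"
        using d(1) T unfolding triangulations_def diagonals_def by blast
      ultimately show ?thesis using p(2)[of d] by metis
    qed
    then have "p \<in> deep_points n" using p(1) unfolding deep_points_def by blast
    moreover have "q = p" if "q \<in> deep_points n" for q
      using that p gen_value[OF that] by (intro points_eqI[of q n p]) (auto simp: deep_points_iff)
    ultimately have "deep_points n = {p}" by blast
    moreover have "p (cluster_gen n (i, j)) =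
        (if i mod 2 \<noteq> j mod 2 then (- 1) ^ ((j - i - 1) div 2) else 0)"
      if "(i, j) \<in> diagonals (n + 3)" for i j
    proof -
      have s: "(i, j) \<in> segments (n + 3)" using that unfolding diagonals_def by blast
      then have "odd (j - i) \<longleftrightarrow> i mod 2 \<noteq> j mod 2"
        unfolding segments_def by (auto simp: mod2_eq_if)
      then show ?thesis using p(2)[OF s] by (simp add: quarter_sine_closed_form[of "j - i"])
    qed
    ultimately show "\<exists>p. (deep_points n :: (zpoly set set \<Rightarrow> 'k) set) = {p} \<and>
        (\<forall>(i, j) \<in> diagonals (n + 3). p (cluster_gen n (i, j)) =
          (if i mod 2 \<noteq> j mod 2 then (- 1) ^ ((j - i - 1) div 2) else 0))"
      by blast
  next
    assume no: "\<not> (n mod 4 = 3 \<or> (n mod 4 = 1 \<and> CHAR('k) = 2))"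
    have False if p: "p \<in> deep_points n" for p :: "zpoly set set \<Rightarrow> 'k"
    proof -
      have "p (cluster_gen n (1, n + 3)) = 1"
        using p frieze_last_edge[of "n + 3"] unfolding deep_points_iff deep_frieze_def by fastforce
      moreover have "p (cluster_gen n (1, n + 3)) = quarter_sine (n + 2)"
        using gen_value[OF p, of "(1, n + 3)"] by (simp add: segments_def)
      ultimately show False using no by (simp only: quarter_sine_closing)
    qed
    then show "(deep_points n :: (zpoly set set \<Rightarrow> 'k) set) = {}" by blast
  qed
qed

end
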